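(* Let $\ell,k\geq 2$ be integers, and let $\mathcal{F}_1,\dots,\mathcal{F}_{k}\subset 2^{[n]}$ be such that $\ell$ divides $|F_1\cap\dots\cap F_{k}|$ for every choice of $F_{1}\in\mathcal{F}_1,\dots,F_{k}\in\mathcal{F}_{k}$. Then $|\mathcal{F}_{1}|\cdots|\mathcal{F}_{k}|\leq 2^{(k-1)n}$. *)

theory Defs
  imports Main
begin

end

theory Submission
  imports Defs
begin

text \<open>
  For \<open>j\<close> a position at which two members \<open>A\<close>, \<open>B\<close> of a family first differ, the vector
  \<open>1\<^sub>A - 1\<^sub>B\<close> vanishes below \<open>j\<close> and is \<open>\<plusminus>1\<close> at \<open>j\<close>; the members of a family are
  distinguished by their traces on the set \<open>L\<close> of such positions, so the family has at most
  \<open>2\<^bsup>card L\<^esup>\<close> members. The same holds for the positions of last differences. Use last differences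
  for one family and first differences for all the others. If some \<open>j\<close> were in all the resulting
  sets \<open>L\<^sub>i\<close>, then the product of the \<open>k\<close> difference vectors would be supported at \<open>j\<close>
  alone (here \<open>k \<ge> 2\<close> matters), so its coordinates would sum to \<open>\<plusminus>1\<close>. By multilinearity that sum
  is a signed sum of cardinalities of intersections, hence divisible by \<open>l\<close>, a contradiction.
  Therefore every point is missed by some \<open>L\<^sub>i\<close>, and \<open>(\<Sum>i. card L\<^sub>i) \<le> (k - 1) n\<close>.
\<close>

text \<open>Read \<open>r i j\<close> as "\<open>i\<close> comes before \<open>j\<close>": first
  differences are the case \<open>(<)\<close>, last differences the case \<open>(>)\<close>. Since
  \<open>A\<close> and \<open>B\<close> may be swapped, fixing \<open>j\<close> to lie in
  \<open>A\<close> loses nothing and makes the difference vector \<open>+1\<close> at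
  \<open>j\<close>.\<close>

definition diff_positions :: "('a \<Rightarrow> 'a \<Rightarrow> bool) \<Rightarrow> 'a set set \<Rightarrow> 'a set" where
  "diff_positions r \<A> =
    {j. \<exists>A\<in>\<A>. \<exists>B\<in>\<A>. j \<in> A \<and> j \<notin> B \<and> (\<forall>i. r i j \<longrightarrow> i \<in> A \<longleftrightarrow> i \<in> B)}"

lemma diff_positions_subset:
  assumes "\<A> \<subseteq> Pow X"
  shows "diff_positions r \<A> \<subseteq> X"
  using assms by (auto simp: diff_positions_def)

lemma card_le_two_power_diff_positions:
  assumes "finite X" "\<A> \<subseteq> Pow X" "asymp r" "transp r"
  shows "card \<A> \<le> 2 ^ card (diff_positions r \<A>)"
proof -
  let ?L = "diff_positions r \<A>"
  have fin: "finite ?L"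
    using diff_positions_subset[OF assms(2)] assms(1) finite_subset by blast
  have "inj_on (\<lambda>A. A \<inter> ?L) \<A>"
  proof (rule inj_onI, rule ccontr)
    fix A B assume AB: "A \<in> \<A>" "B \<in> \<A>" and eq: "A \<inter> ?L = B \<inter> ?L" and ne: "A \<noteq> B"
    let ?D = "(A - B) \<union> (B - A)"
    have "finite ?D" using AB assms by (meson Diff_subset Pow_iff finite_Un finite_subset subsetD)
    moreover have "?D \<noteq> {}" using ne by blast
    moreover have "asymp_on ?D r" "transp_on ?D r"
      using assms by (auto intro: asymp_on_subset transp_on_subset)
    \<comment> \<open>An \<open>r\<close>-minimal element of the symmetric difference is a position
      of first difference in the sense of \<open>r\<close>, so the traces on \<open>?L\<close>
      already differ there.\<close>
    ultimately obtain j where j: "j \<in> ?D" and min: "\<And>i. i \<in> ?D \<Longrightarrow> i \<noteq> j \<Longrightarrow> \<not> r i j"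
      using Finite_Set.bex_min_element[of ?D r] by metis
    have "\<not> r j j" using assms(3) by (meson asympD)
    with min have agree: "\<And>i. r i j \<Longrightarrow> i \<in> A \<longleftrightarrow> i \<in> B" by blast
    have "j \<in> ?L"
      using j AB agree unfolding diff_positions_def by blast
    with j eq show False by blast
  qed
  then have "card \<A> = card ((\<lambda>A. A \<inter> ?L) ` \<A>)" by (simp add: card_image)
  also have "\<dots> \<le> card (Pow ?L)" using fin by (intro card_mono) auto
  also have "\<dots> = 2 ^ card ?L" using fin by (simp add: card_Pow)
  finally show ?thesis .
qed

text \<open>The set \<open>J\<close> interpolates between the hypothesis (\<open>J = {}\<close>) and
  the full product of differences (\<open>J = I\<close>), one factor at a time.\<close>

lemma dvd_sum_prod_differences:
  fixes l :: int
  assumes "finite I" "J \<subseteq> I"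
    and dvd: "\<And>F. (\<And>i. i \<in> I \<Longrightarrow> F i \<in> \<F> i) \<Longrightarrow> l dvd (\<Sum>x\<in>X. \<Prod>i\<in>I. of_bool (x \<in> F i))"
    and "\<And>i. i \<in> I \<Longrightarrow> F i \<in> \<F> i" "\<And>i. i \<in> I \<Longrightarrow> G i \<in> \<F> i"
  shows "l dvd (\<Sum>x\<in>X. (\<Prod>i\<in>J. of_bool (x \<in> F i) - of_bool (x \<in> G i))
                   * (\<Prod>i\<in>I - J. of_bool (x \<in> F i)))"
proof -
  have "finite J" using assms(1,2) finite_subset by blast
  then show ?thesis using assms(2,4,5)
  proof (induction J arbitrary: F rule: finite_induct)
    case empty
    then show ?case using dvd by simp
  next
    case (insert a J)
    let ?S = "\<lambda>F. \<Sum>x\<in>X. (\<Prod>i\<in>J. of_bool (x \<in> F i) - of_bool (x \<in> G i))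
                          * (\<Prod>i\<in>I - J. of_bool (x \<in> F i) :: int)"
    \<comment> \<open>Expanding the factor at \<open>a\<close> gives two sums for \<open>J\<close>,
      one with \<open>F a\<close> and one with \<open>G a\<close> in its place; hence the induction
      keeps \<open>F\<close> arbitrary.\<close>
    let ?F = "F(a := G a)"
    have split: "(\<Prod>i\<in>I - J. h i) = h a * (\<Prod>i\<in>I - insert a J. h i)" for h :: "_ \<Rightarrow> int"
    proof -
      have "finite (I - J)" "a \<in> I - J" using insert.hyps insert.prems(1) assms(1) by auto
      then show ?thesis unfolding Diff_insert[of I a J] by (rule prod.remove)
    qed
    have "(\<Prod>i\<in>J. of_bool (x \<in> ?F i) - of_bool (x \<in> G i) :: int)
        = (\<Prod>i\<in>J. of_bool (x \<in> F i) - of_bool (x \<in> G i))"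
      and "(\<Prod>i\<in>I - insert a J. of_bool (x \<in> ?F i) :: int)
        = (\<Prod>i\<in>I - insert a J. of_bool (x \<in> F i))" for x
      using insert.hyps by (auto intro!: prod.cong)
    then have "(\<Prod>i\<in>insert a J. of_bool (x \<in> F i) - of_bool (x \<in> G i))
                   * (\<Prod>i\<in>I - insert a J. of_bool (x \<in> F i) :: int)
        = (\<Prod>i\<in>J. of_bool (x \<in> F i) - of_bool (x \<in> G i)) * (\<Prod>i\<in>I - J. of_bool (x \<in> F i))
        - (\<Prod>i\<in>J. of_bool (x \<in> ?F i) - of_bool (x \<in> G i)) * (\<Prod>i\<in>I - J. of_bool (x \<in> ?F i))"
      for x
      unfolding split prod.insert[OF insert.hyps] by (simp only: fun_upd_same algebra_simps)
    then have "(\<Sum>x\<in>X. (\<Prod>i\<in>insert a J. of_bool (x \<in> F i) - of_bool (x \<in> G i))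
                   * (\<Prod>i\<in>I - insert a J. of_bool (x \<in> F i) :: int)) = ?S F - ?S ?F"
      by (simp only: sum_subtractf)
    moreover have "l dvd ?S F" "l dvd ?S ?F"
      by (rule insert.IH; use insert.prems in simp)+
    ultimately show ?case by (simp only: dvd_diff)
  qed
qed

text \<open>The complements \<open>X - L i\<close> cover \<open>X\<close>, so their sizes add up to
  at least \<open>card X\<close>.\<close>

lemma sum_card_le_if_no_common_point:
  assumes "finite I" "finite X" "\<And>i. i \<in> I \<Longrightarrow> L i \<subseteq> X" "I \<noteq> {}" "(\<Inter>i\<in>I. L i) = {}"
  shows "(\<Sum>i\<in>I. card (L i)) \<le> (card I - 1) * card X"
proof -
  have "X = (\<Union>i\<in>I. X - L i)" using assms(4,5) by auto
  then have "card X \<le> (\<Sum>i\<in>I. card (X - L i))"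
    using card_UN_le[OF assms(1), of "\<lambda>i. X - L i"] by simp
  moreover have "(\<Sum>i\<in>I. card (X - L i)) + (\<Sum>i\<in>I. card (L i)) = card I * card X"
  proof -
    have "card (X - L i) + card (L i) = card X" if "i \<in> I" for i
      using assms(2,3) that by (metis card_Diff_subset card_mono finite_subset le_add_diff_inverse2)
    then show ?thesis by (simp flip: sum.distrib)
  qed
  ultimately show ?thesis by (simp add: diff_mult_distrib)
qed

lemma prod_card_le_if_dvd_card_INT:
  fixes \<F> :: "'i \<Rightarrow> 'a::linorder set set"
  assumes "finite I" "card I \<ge> 2" "finite X" "l \<ge> 2"
    and sub: "\<And>i. i \<in> I \<Longrightarrow> \<F> i \<subseteq> Pow X"
    and dvd: "\<And>F. (\<And>i. i \<in> I \<Longrightarrow> F i \<in> \<F> i) \<Longrightarrow> l dvd card (\<Inter>i\<in>I. F i)"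
  shows "(\<Prod>i\<in>I. card (\<F> i)) \<le> 2 ^ ((card I - 1) * card X)"
proof -
  obtain a b where ab: "a \<in> I" "b \<in> I" "a \<noteq> b"
    using assms(2) by (metis card_2_iff obtain_subset_with_card_n insert_subset)
  \<comment> \<open>The index \<open>b\<close> uses last differences; \<open>a\<close> guarantees
    that some index uses first differences.\<close>
  define r :: "'i \<Rightarrow> 'a \<Rightarrow> 'a \<Rightarrow> bool" where "r i = (if i = b then (>) else (<))" for i
  define L where "L i = diff_positions (r i) (\<F> i)" for i
  have asymp: "asymp (r i)" and transp: "transp (r i)" for i
    by (auto simp: r_def)
  have "(\<Inter>i\<in>I. L i) = {}"
  proof (rule ccontr)
    assume "(\<Inter>i\<in>I. L i) \<noteq> {}"
    then obtain j where "\<And>i. i \<in> I \<Longrightarrow> j \<in> L i" by blast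
    then have "\<forall>i\<in>I. \<exists>A B. A \<in> \<F> i \<and> B \<in> \<F> i \<and> j \<in> A \<and> j \<notin> B \<and> (\<forall>x. r i x j \<longrightarrow> x \<in> A \<longleftrightarrow> x \<in> B)"
      unfolding L_def diff_positions_def by blast
    then obtain F G where FG: "\<And>i. i \<in> I \<Longrightarrow> F i \<in> \<F> i" "\<And>i. i \<in> I \<Longrightarrow> G i \<in> \<F> i"
      "\<And>i. i \<in> I \<Longrightarrow> j \<in> F i" "\<And>i. i \<in> I \<Longrightarrow> j \<notin> G i"
      "\<And>i x. i \<in> I \<Longrightarrow> r i x j \<Longrightarrow> x \<in> F i \<longleftrightarrow> x \<in> G i"
      unfolding bchoice_iff by blast
    let ?d = "\<lambda>x. \<Prod>i\<in>I. of_bool (x \<in> F i) - of_bool (x \<in> G i) :: int"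
    \<comment> \<open>A product of indicators is the indicator of the intersection, so this sum is
      its cardinality.\<close>
    have "int l dvd (\<Sum>x\<in>X. \<Prod>i\<in>I. of_bool (x \<in> H i))" if H: "\<And>i. i \<in> I \<Longrightarrow> H i \<in> \<F> i" for H
    proof -
      have "(\<Prod>i\<in>I. of_bool (x \<in> H i) :: int) = of_bool (x \<in> (\<Inter>i\<in>I. H i))" for x
        using assms(1) by (auto simp: prod_eq_1_iff)
      moreover have "X \<inter> (\<Inter>i\<in>I. H i) = (\<Inter>i\<in>I. H i)"
        using H sub ab(1) by blast
      ultimately show ?thesis using dvd[of H] H assms(3) by (simp add: sum_of_bool_eq Int_def)
    qed
    from dvd_sum_prod_differences[OF assms(1) order_refl, of \<F> "int l" X F G, OF this FG(1,2)]
    have "int l dvd (\<Sum>x\<in>X. ?d x)" by simp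
    also have "(\<Sum>x\<in>X. ?d x) = (\<Sum>x\<in>{j}. ?d x)"
    proof (rule sum.mono_neutral_right)
      show "{j} \<subseteq> X" using FG(1,3)[OF ab(1)] sub[OF ab(1)] by blast
      show "\<forall>x\<in>X - {j}. ?d x = 0"
      proof
        fix x assume "x \<in> X - {j}"
        then consider "x < j" | "x > j" by fastforce
        \<comment> \<open>The factor of \<open>a\<close> vanishes below \<open>j\<close>, that of
          \<open>b\<close> above \<open>j\<close>.\<close>
        then have "\<exists>i\<in>I. r i x j" using ab by cases (auto simp: r_def)
        then show "?d x = 0" using FG(5) assms(1) by (auto simp: prod_zero_iff)
      qed
    qed (use assms in simp)
    also have "\<dots> = 1" using FG(3,4) by simp
    finally show False using assms(4) by simp
  qed
  moreover have "L i \<subseteq> X" if "i \<in> I" for i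
    using diff_positions_subset[OF sub[OF that]] by (simp add: L_def)
  ultimately have "(\<Sum>i\<in>I. card (L i)) \<le> (card I - 1) * card X"
    using assms(1,3) ab(1) by (intro sum_card_le_if_no_common_point) auto
  moreover have "(\<Prod>i\<in>I. card (\<F> i)) \<le> (\<Prod>i\<in>I. 2 ^ card (L i))"
    using card_le_two_power_diff_positions[OF assms(3) sub asymp transp]
    by (intro prod_mono) (auto simp: L_def)
  ultimately show ?thesis
    by (simp add: power_sum[symmetric]) (meson one_le_numeral order_trans power_increasing)
qed

theorem theorem6p1:
  fixes l k n :: nat
    and \<F> :: "nat \<Rightarrow> nat set set"
  assumes "l \<ge> 2" and "k \<ge> 2"
    and "\<And>i. i \<in> {1..k} \<Longrightarrow> \<F> i \<subseteq> Pow {1..n}"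
    and "\<And>F :: nat \<Rightarrow> nat set. (\<And>i. i \<in> {1..k} \<Longrightarrow> F i \<in> \<F> i) \<Longrightarrow> l dvd card (\<Inter>i\<in>{1..k}. F i)"
  shows "(\<Prod>i\<in>{1..k}. card (\<F> i)) \<le> 2 ^ ((k - 1) * n)"
  using prod_card_le_if_dvd_card_INT[of "{1..k}" "{1..n}" l \<F>] assms by simp

end
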